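(* Let $r, m$ be positive integers and let $\theta \in \mathbb{R}^{n_\theta}$ be a parameter vector partitioned as $\theta = [\theta_J^{\mathsf T}, \theta_W^{\mathsf T}, \theta_Q^{\mathsf T}, \theta_G^{\mathsf T}, \theta_N^{\mathsf T}]^{\mathsf T}$ with $\theta_J \in \mathbb{R}^{r(r-1)/2}$, $\theta_W \in \mathbb{R}^{(r+m)(r+m+1)/2}$, $\theta_Q \in \mathbb{R}^{r(r+1)/2}$, $\theta_G \in \mathbb{R}^{r\cdot m}$, and $\theta_N \in \mathbb{R}^{m(m-1)/2}$. Define the matrix-valued functions $$ \begin{aligned} J_r(\theta) &:= \mathrm{vtsu}(\theta_J)^{\mathsf T} - \mathrm{vtsu}(\theta_J),\\ W_r(\theta) &:= \mathrm{vtu}(\theta_W)\,\mathrm{vtu}(\theta_W)^{\mathsf T},\\ R_r(\theta) &:= \begin{bmatrix} I_r & 0\end{bmatrix} W_r(\theta) \begin{bmatrix} I_r & 0\end{bmatrix}^{\mathsf T},\\ P_r(\theta) &:= \begin{bmatrix} I_r & 0\end{bmatrix} W_r(\theta) \begin{bmatrix} 0 & I_m\end{bmatrix}^{\mathsf T},\\ S_r(\theta) &:= \begin{bmatrix} 0 & I_m\end{bmatrix} W_r(\theta) \begin{bmatrix} 0 & I_m\end{bmatrix}^{\mathsf T},\\ Q_r(\theta) &:= \mathrm{vtu}(\theta_Q)\,\mathrm{vtu}(\theta_Q)^{\mathsf T},\\ G_r(\theta) &:= \mathrm{vtf}_m(\theta_G),\\ N_r(\theta) &:= \mathrm{vtsu}(\theta_N)^{\mathsf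 T} - \mathrm{vtsu}(\theta_N). \end{aligned} $$ Then the parametric system $$ \begin{aligned} \dot x_r(t) &= (J_r(\theta)-R_r(\theta))Q_r(\theta)x_r(t) + (G_r(\theta)-P_r(\theta))u(t),\\ y_r(t) &= (G_r(\theta)+P_r(\theta))^{\mathsf T}Q_r(\theta)x_r(t) + (S_r(\theta)-N_r(\theta))u(t) \end{aligned} $$ is a port-Hamiltonian differential-algebraic equation (pH-DAE) with $E_r = I_r$.
   Context: Reshaping functions: $\mathrm{vtu}(\cdot)$ maps a vector in $\mathbb{R}^{k(k+1)/2}$ row-wise to an upper triangular matrix in $\mathbb{R}^{k\times k}$ (its entries fill the upper triangle including the diagonal, row by row; all other entries are zero). $\mathrm{vtsu}(\cdot)$ maps a vector in $\mathbb{R}^{k(k-1)/2}$ row-wise to a strictly upper triangular matrix in $\mathbb{R}^{k\times k}$. $\mathrm{vtf}_m(\cdot)$ is the standard reshape operation mapping a vector in $\mathbb{R}^{r\cdot m}$ to a matrix in $\mathbb{R}^{r\times m}$. Definition (pH-DAE): a linear constant-coefficient system $$E\dot x(t) = (J-R)Qx(t) + (G-P)u(t),\qquad y(t) = (G+P)^{\mathsf T}Qx(t) + (S-N)u(t),$$ with $E,Q,J,R\in\mathbb{R}^{n\times n}$, $G,P\in\mathbb{R}^{n\times m}$, $S,N\in\mathbb{R}^{m\times m}$, is called a port-Hamiltonian differential-algebraic equation (pH-DAE) if (i) the matrices $Q^{\mathsf T}JQ$ and $N$ are skew-symmetric; and (ii) the passivity matrix $$\begin{bmatrix} Q^{\mathsf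 T}RQ & Q^{\mathsf T}P\\ P^{\mathsf T}Q & S\end{bmatrix}$$ and the product $Q^{\mathsf T}E$ are symmetric positive semi-definite. *)

theory Defs
  imports Complex_Main "Jordan_Normal_Form.Matrix"
begin

section \<open>Reshaping functions\<close>

text \<open>Indices are 0-based. Row \<open>l\<close> of the upper triangle (with diagonal) of a \<open>k \<times> k\<close> matrix has
  \<open>k - l\<close> entries, so row \<open>i\<close> starts at position \<open>\<Sum>l<i. k - l\<close> of the vector; for the strict upper
  triangle row \<open>l\<close> has \<open>k - 1 - l\<close> entries.\<close>

definition vtu :: "nat \<Rightarrow> real vec \<Rightarrow> real mat" where
  "vtu k v = mat k k (\<lambda>(i, j). if i \<le> j then v $ ((\<Sum>l<i. k - l) + (j - i)) else 0)"

definition vtsu :: "nat \<Rightarrow> real vec \<Rightarrow> real mat" where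
  "vtsu k v = mat k k (\<lambda>(i, j). if i < j then v $ ((\<Sum>l<i. k - 1 - l) + (j - i - 1)) else 0)"

text \<open>The standard reshape of a vector of dimension \<open>r * m\<close> is taken column by column,
  i.e. it is the inverse of column-wise vectorization.\<close>

definition vtf :: "nat \<Rightarrow> nat \<Rightarrow> real vec \<Rightarrow> real mat" where
  "vtf r m v = mat r m (\<lambda>(i, j). v $ (j * r + i))"

section \<open>Port-Hamiltonian differential-algebraic equations\<close>

definition skew_symmetric :: "real mat \<Rightarrow> bool" where
  "skew_symmetric A \<longleftrightarrow> square_mat A \<and> transpose_mat A = - A"

definition symmetric_psd :: "real mat \<Rightarrow> bool" where
  "symmetric_psd A \<longleftrightarrow> square_mat A \<and> transpose_mat A = A \<and>
     (\<forall>v \<in> carrier_vec (dim_row A). 0 \<le> v \<bullet> (A *\<^sub>v v))"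

text \<open>The type \<open>real vec\<close> carries no topology, so derivatives of vector-valued functions are
  taken componentwise.\<close>

definition has_vec_deriv :: "(real \<Rightarrow> real vec) \<Rightarrow> real vec \<Rightarrow> real filter \<Rightarrow> bool" where
  "has_vec_deriv x d F \<longleftrightarrow> (\<forall>i < dim_vec d. ((\<lambda>s. x s $ i) has_real_derivative d $ i) F)"

type_synonym trajectory = "(real \<Rightarrow> real vec) \<times> (real \<Rightarrow> real vec) \<times> (real \<Rightarrow> real vec)"

text \<open>A system is represented by the set of its trajectories \<open>(x, u, y)\<close> (state, input, output)
  over a time domain \<open>T\<close>.\<close>

definition ph_system :: "real set \<Rightarrow> nat \<Rightarrow> nat \<Rightarrow> real mat \<Rightarrow> real mat \<Rightarrow> real mat \<Rightarrow> real mat \<Rightarrow>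
    real mat \<Rightarrow> real mat \<Rightarrow> real mat \<Rightarrow> real mat \<Rightarrow> trajectory set" where
  "ph_system T n m E J R Q G P S N = {(x, u, y). \<forall>t \<in> T.
     x t \<in> carrier_vec n \<and> u t \<in> carrier_vec m \<and> y t \<in> carrier_vec m \<and>
     (\<exists>xd \<in> carrier_vec n. has_vec_deriv x xd (at t within T) \<and>
        E *\<^sub>v xd = ((J - R) * Q) *\<^sub>v x t + (G - P) *\<^sub>v u t) \<and>
     y t = (transpose_mat (G + P) * Q) *\<^sub>v x t + (S - N) *\<^sub>v u t}"

definition passivity_mat :: "real mat \<Rightarrow> real mat \<Rightarrow> real mat \<Rightarrow> real mat \<Rightarrow> real mat" where
  "passivity_mat R Q P S = four_block_mat
     (transpose_mat Q * R * Q) (transpose_mat Q * P)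
     (transpose_mat P * Q)     S"

text \<open>The system \<open>\<Sigma>\<close> with \<open>n\<close> states and \<open>m\<close> inputs and outputs is a pH-DAE with the coefficient
  matrices \<open>E, J, R, Q, G, P, S, N\<close>.\<close>

definition pH_DAE :: "real set \<Rightarrow> nat \<Rightarrow> nat \<Rightarrow> real mat \<Rightarrow> real mat \<Rightarrow> real mat \<Rightarrow> real mat \<Rightarrow>
    real mat \<Rightarrow> real mat \<Rightarrow> real mat \<Rightarrow> real mat \<Rightarrow> trajectory set \<Rightarrow> bool" where
  "pH_DAE T n m E J R Q G P S N \<Sigma> \<longleftrightarrow>
     {E, Q, J, R} \<subseteq> carrier_mat n n \<and> {G, P} \<subseteq> carrier_mat n m \<and> {S, N} \<subseteq> carrier_mat m m \<and>
     \<Sigma> = ph_system T n m E J R Q G P S N \<and>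
     skew_symmetric (transpose_mat Q * J * Q) \<and> skew_symmetric N \<and>
     symmetric_psd (passivity_mat R Q P S) \<and> symmetric_psd (transpose_mat Q * E)"

section \<open>The parametrization\<close>

definition n_J :: "nat \<Rightarrow> nat \<Rightarrow> nat" where "n_J r m = r * (r - 1) div 2"
definition n_W :: "nat \<Rightarrow> nat \<Rightarrow> nat" where "n_W r m = (r + m) * (r + m + 1) div 2"
definition n_Q :: "nat \<Rightarrow> nat \<Rightarrow> nat" where "n_Q r m = r * (r + 1) div 2"
definition n_G :: "nat \<Rightarrow> nat \<Rightarrow> nat" where "n_G r m = r * m"
definition n_N :: "nat \<Rightarrow> nat \<Rightarrow> nat" where "n_N r m = m * (m - 1) div 2"

definition n_theta :: "nat \<Rightarrow> nat \<Rightarrow> nat" where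
  "n_theta r m = n_J r m + n_W r m + n_Q r m + n_G r m + n_N r m"

definition subvec :: "real vec \<Rightarrow> nat \<Rightarrow> nat \<Rightarrow> real vec" where
  "subvec v start len = vec len (\<lambda>i. v $ (start + i))"

definition theta_J :: "nat \<Rightarrow> nat \<Rightarrow> real vec \<Rightarrow> real vec" where
  "theta_J r m \<theta> = subvec \<theta> 0 (n_J r m)"
definition theta_W :: "nat \<Rightarrow> nat \<Rightarrow> real vec \<Rightarrow> real vec" where
  "theta_W r m \<theta> = subvec \<theta> (n_J r m) (n_W r m)"
definition theta_Q :: "nat \<Rightarrow> nat \<Rightarrow> real vec \<Rightarrow> real vec" where
  "theta_Q r m \<theta> = subvec \<theta> (n_J r m + n_W r m) (n_Q r m)"
definition theta_G :: "nat \<Rightarrow> nat \<Rightarrow> real vec \<Rightarrow> real vec" where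
  "theta_G r m \<theta> = subvec \<theta> (n_J r m + n_W r m + n_Q r m) (n_G r m)"
definition theta_N :: "nat \<Rightarrow> nat \<Rightarrow> real vec \<Rightarrow> real vec" where
  "theta_N r m \<theta> = subvec \<theta> (n_J r m + n_W r m + n_Q r m + n_G r m) (n_N r m)"

lemma theta_partition:
  assumes "\<theta> \<in> carrier_vec (n_theta r m)"
  shows "\<theta> = theta_J r m \<theta> @\<^sub>v theta_W r m \<theta> @\<^sub>v theta_Q r m \<theta> @\<^sub>v theta_G r m \<theta> @\<^sub>v theta_N r m \<theta>"
  using assms
  by (intro eq_vecI)
    (auto simp: theta_J_def theta_W_def theta_Q_def theta_G_def theta_N_def subvec_def n_theta_def)

text \<open>The block rows \<open>[I\<^sub>r 0]\<close> and \<open>[0 I\<^sub>m]\<close> with \<open>r + m\<close> columns; the lower blocks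
  are empty.\<close>

definition sel_top :: "nat \<Rightarrow> nat \<Rightarrow> real mat" where
  "sel_top r m = four_block_mat (1\<^sub>m r) (0\<^sub>m r m) (0\<^sub>m 0 r) (0\<^sub>m 0 m)"

definition sel_bot :: "nat \<Rightarrow> nat \<Rightarrow> real mat" where
  "sel_bot r m = four_block_mat (0\<^sub>m m r) (1\<^sub>m m) (0\<^sub>m 0 r) (0\<^sub>m 0 m)"

definition J_r :: "nat \<Rightarrow> nat \<Rightarrow> real vec \<Rightarrow> real mat" where
  "J_r r m \<theta> = transpose_mat (vtsu r (theta_J r m \<theta>)) - vtsu r (theta_J r m \<theta>)"

definition W_r :: "nat \<Rightarrow> nat \<Rightarrow> real vec \<Rightarrow> real mat" where
  "W_r r m \<theta> = vtu (r + m) (theta_W r m \<theta>) * transpose_mat (vtu (r + m) (theta_W r m \<theta>))"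

definition R_r :: "nat \<Rightarrow> nat \<Rightarrow> real vec \<Rightarrow> real mat" where
  "R_r r m \<theta> = sel_top r m * W_r r m \<theta> * transpose_mat (sel_top r m)"

definition P_r :: "nat \<Rightarrow> nat \<Rightarrow> real vec \<Rightarrow> real mat" where
  "P_r r m \<theta> = sel_top r m * W_r r m \<theta> * transpose_mat (sel_bot r m)"

definition S_r :: "nat \<Rightarrow> nat \<Rightarrow> real vec \<Rightarrow> real mat" where
  "S_r r m \<theta> = sel_bot r m * W_r r m \<theta> * transpose_mat (sel_bot r m)"

definition Q_r :: "nat \<Rightarrow> nat \<Rightarrow> real vec \<Rightarrow> real mat" where
  "Q_r r m \<theta> = vtu r (theta_Q r m \<theta>) * transpose_mat (vtu r (theta_Q r m \<theta>))"

definition G_r :: "nat \<Rightarrow> nat \<Rightarrow> real vec \<Rightarrow> real mat" where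
  "G_r r m \<theta> = vtf r m (theta_G r m \<theta>)"

definition N_r :: "nat \<Rightarrow> nat \<Rightarrow> real vec \<Rightarrow> real mat" where
  "N_r r m \<theta> = transpose_mat (vtsu m (theta_N r m \<theta>)) - vtsu m (theta_N r m \<theta>)"

definition param_system :: "real set \<Rightarrow> nat \<Rightarrow> nat \<Rightarrow> real vec \<Rightarrow> trajectory set" where
  "param_system T r m \<theta> = {(x, u, y). \<forall>t \<in> T.
     x t \<in> carrier_vec r \<and> u t \<in> carrier_vec m \<and> y t \<in> carrier_vec m \<and>
     has_vec_deriv x
       (((J_r r m \<theta> - R_r r m \<theta>) * Q_r r m \<theta>) *\<^sub>v x t + (G_r r m \<theta> - P_r r m \<theta>) *\<^sub>v u t)
       (at t within T) \<and>
     y t = (transpose_mat (G_r r m \<theta> + P_r r m \<theta>) * Q_r r m \<theta>) *\<^sub>v x t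
           + (S_r r m \<theta> - N_r r m \<theta>) *\<^sub>v u t}"

end

theory Submission
  imports Defs
begin

text \<open>A Gram matrix \<open>M * M\<^sup>T\<close> is symmetric positive semi-definite, and both
  semi-definiteness conditions are instances of this. Write \<open>L = vtu(\<theta>\<^sub>W)\<close> and let
  \<open>A = [I 0] L\<close> and \<open>B = [0 I] L\<close> be its upper and lower block rows. Then \<open>R = A A\<^sup>T\<close>,
  \<open>P = A B\<^sup>T\<close> and \<open>S = B B\<^sup>T\<close>, so for any \<open>Q\<close> the passivity matrix is the Gram matrix of the
  block column with blocks \<open>Q\<^sup>T A\<close> and \<open>B\<close> (lemma \<open>passivity_mat_of_factors_psd\<close>). Since \<open>E\<close>
  is the identity, \<open>Q\<^sup>T E = Q\<close> is itself the Gram matrix of \<open>vtu(\<theta>\<^sub>Q)\<close>.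

  The conservative part is skew-symmetric because \<open>J\<close> and \<open>N\<close> have the form \<open>V\<^sup>T - V\<close>, and
  skew-symmetry is preserved by the congruence \<open>Q\<^sup>T J Q\<close>. Finally, \<open>E = I\<close> makes the implicit
  equation \<open>E x' = f\<close> the same as \<open>x' = f\<close>, so the two trajectory sets agree.\<close>

lemma vtu_carrier [simp]: "vtu k v \<in> carrier_mat k k"
  by (simp add: vtu_def)

lemma vtsu_carrier [simp]: "vtsu k v \<in> carrier_mat k k"
  by (simp add: vtsu_def)

lemma vtf_carrier [simp]: "vtf r m v \<in> carrier_mat r m"
  by (simp add: vtf_def)

lemma sel_top_carrier [simp]: "sel_top r m \<in> carrier_mat r (r + m)"
  unfolding sel_top_def by (rule carrier_matI) simp_all

lemma sel_bot_carrier [simp]: "sel_bot r m \<in> carrier_mat m (r + m)"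
  unfolding sel_bot_def by (rule carrier_matI) simp_all

lemma skew_symmetric_transpose_minus:
  assumes "A \<in> carrier_mat n n"
  shows "skew_symmetric (transpose_mat A - A)"
proof -
  have "transpose_mat (transpose_mat A - A) = - (transpose_mat A - A)"
    by (rule eq_matI) (use assms in auto)
  then show ?thesis using assms by (simp add: skew_symmetric_def)
qed

lemma skew_symmetric_congruence:
  assumes J: "J \<in> carrier_mat n n" and Q: "Q \<in> carrier_mat n p" and skew: "skew_symmetric J"
  shows "skew_symmetric (transpose_mat Q * J * Q)"
proof -
  have QT: "transpose_mat Q \<in> carrier_mat p n" using Q by simp
  have JT: "transpose_mat J = - J" using skew by (simp only: skew_symmetric_def)
  have "transpose_mat (transpose_mat Q * J * Q) = transpose_mat Q * (transpose_mat J * Q)"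
    by (simp only: transpose_mult[OF mult_carrier_mat[OF QT J] Q] transpose_mult[OF QT J]
        transpose_transpose)
  also have "\<dots> = transpose_mat Q * (- (J * Q))"
    unfolding JT by (subst uminus_mult_left_mat) (use J Q in auto)
  also have "\<dots> = - (transpose_mat Q * (J * Q))"
    by (rule uminus_mult_right_mat) (use J Q in auto)
  also have "\<dots> = - (transpose_mat Q * J * Q)"
    by (simp only: assoc_mult_mat[OF QT J Q])
  finally show ?thesis
    using Q by (simp only: skew_symmetric_def) simp
qed

text \<open>The quadratic form of \<open>A A\<^sup>T\<close> at \<open>v\<close> is the squared norm of \<open>A\<^sup>T v\<close>.\<close>

lemma symmetric_psd_gram:
  assumes A: "A \<in> carrier_mat n k"
  shows "symmetric_psd (A * transpose_mat A)"
proof -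
  have AT: "transpose_mat A \<in> carrier_mat k n" using A by simp
  have "0 \<le> v \<bullet> ((A * transpose_mat A) *\<^sub>v v)" if v: "v \<in> carrier_vec n" for v
  proof -
    define w where "w = transpose_mat A *\<^sub>v v"
    have w: "w \<in> carrier_vec k" using AT v by (simp add: w_def)
    have "v \<bullet> ((A * transpose_mat A) *\<^sub>v v) = v \<bullet> (A *\<^sub>v w)"
      by (simp add: assoc_mult_mat_vec[OF A AT v] w_def)
    also have "\<dots> = w \<bullet> w"
      using transpose_vec_mult_scalar[OF A w v] by (simp add: w_def)
    also have "\<dots> \<ge> 0" by (simp add: scalar_prod_def sum_nonneg)
    finally show ?thesis .
  qed
  then show ?thesis
    using A transpose_mult[OF A AT] by (simp add: symmetric_psd_def)
qed

lemma gram_of_block_column: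
  fixes X Y :: "real mat"
  assumes X: "X \<in> carrier_mat a k" and Y: "Y \<in> carrier_mat b k"
  shows "four_block_mat (X * transpose_mat X) (X * transpose_mat Y)
           (Y * transpose_mat X) (Y * transpose_mat Y)
         = (X @\<^sub>r Y) * transpose_mat (X @\<^sub>r Y)"
proof -
  \<comment> \<open>Row stacking is a four-block matrix whose right blocks have no columns, so their products
    with the empty lower blocks of the transpose contribute zero summands.\<close>
  have z: "0\<^sub>m a 0 \<in> carrier_mat a 0" "0\<^sub>m b 0 \<in> carrier_mat b 0" by simp_all
  have "X @\<^sub>r Y = four_block_mat X (0\<^sub>m a 0) Y (0\<^sub>m b 0)"
    using X Y by (simp add: append_rows_def)
  moreover have "transpose_mat (four_block_mat X (0\<^sub>m a 0) Y (0\<^sub>m b 0))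
      = four_block_mat (transpose_mat X) (transpose_mat Y) (0\<^sub>m 0 a) (0\<^sub>m 0 b)"
    using transpose_four_block_mat[OF X z(1) Y z(2)] by simp
  moreover have "four_block_mat X (0\<^sub>m a 0) Y (0\<^sub>m b 0)
        * four_block_mat (transpose_mat X) (transpose_mat Y) (0\<^sub>m 0 a) (0\<^sub>m 0 b)
      = four_block_mat (X * transpose_mat X) (X * transpose_mat Y)
          (Y * transpose_mat X) (Y * transpose_mat Y)"
    by (subst mult_four_block_mat[OF X z(1) Y z(2)]) (use X Y in auto)
  ultimately show ?thesis by simp
qed

text \<open>The passivity matrix of the factors \<open>A\<close> and \<open>B\<close> is the congruence of
  \<open>[A; B] [A; B]\<^sup>T\<close> by \<open>diag(Q, I)\<close>, hence the Gram matrix of \<open>[Q\<^sup>T A; B]\<close>; the semicolon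
  separates block rows.\<close>

lemma passivity_mat_of_factors_psd:
  assumes A: "A \<in> carrier_mat n k" and B: "B \<in> carrier_mat m k" and Q: "Q \<in> carrier_mat n p"
  shows "symmetric_psd (passivity_mat (A * transpose_mat A) Q (A * transpose_mat B)
           (B * transpose_mat B))"
proof -
  let ?X = "transpose_mat Q * A"
  have QT: "transpose_mat Q \<in> carrier_mat p n" and AT: "transpose_mat A \<in> carrier_mat k n"
    and BT: "transpose_mat B \<in> carrier_mat k m"
    using A B Q by simp_all
  have X: "?X \<in> carrier_mat p k" using QT A by simp
  have XT: "transpose_mat ?X = transpose_mat A * Q"
    using transpose_mult[OF QT A] by simp
  have "transpose_mat Q * (A * transpose_mat A) * Q = ?X * transpose_mat ?X"
    unfolding XT assoc_mult_mat[OF QT A AT, symmetric]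
    by (rule assoc_mult_mat[OF X AT Q])
  moreover have "transpose_mat Q * (A * transpose_mat B) = ?X * transpose_mat B"
    by (rule assoc_mult_mat[OF QT A BT, symmetric])
  moreover have "transpose_mat (A * transpose_mat B) * Q = B * transpose_mat ?X"
    unfolding XT transpose_mult[OF A BT] transpose_transpose
    by (rule assoc_mult_mat[OF B AT Q])
  ultimately have "passivity_mat (A * transpose_mat A) Q (A * transpose_mat B)
      (B * transpose_mat B) = (?X @\<^sub>r B) * transpose_mat (?X @\<^sub>r B)"
    by (simp only: passivity_mat_def gram_of_block_column[OF X B])
  then show ?thesis
    using symmetric_psd_gram[OF carrier_append_rows[OF X B]] by simp
qed

text \<open>Multiplying \<open>L L\<^sup>T\<close> by selectors on both sides selects rows of the factor \<open>L\<close>; this is how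
  the blocks of \<open>W\<close> acquire the factored form that the previous lemma asks for.\<close>

lemma product_of_selected_rows:
  fixes L :: "real mat"
  assumes C: "C \<in> carrier_mat a n" and L: "L \<in> carrier_mat n k" and D: "D \<in> carrier_mat b n"
  shows "C * (L * transpose_mat L) * transpose_mat D = (C * L) * transpose_mat (D * L)"
proof -
  have LT: "transpose_mat L \<in> carrier_mat k n" and DT: "transpose_mat D \<in> carrier_mat n b"
    using L D by simp_all
  show ?thesis
    unfolding transpose_mult[OF D L] assoc_mult_mat[OF C L LT, symmetric]
    by (rule assoc_mult_mat[OF mult_carrier_mat[OF C L] LT DT])
qed

lemma param_system_eq_ph_system:
  "param_system T r m \<theta> = ph_system T r m (1\<^sub>m r) (J_r r m \<theta>) (R_r r m \<theta>) (Q_r r m \<theta>)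
     (G_r r m \<theta>) (P_r r m \<theta>) (S_r r m \<theta>) (N_r r m \<theta>)"
proof -
  let ?f = "\<lambda>x u. ((J_r r m \<theta> - R_r r m \<theta>) * Q_r r m \<theta>) *\<^sub>v x + (G_r r m \<theta> - P_r r m \<theta>) *\<^sub>v u"
  have f: "?f x u \<in> carrier_vec r" for x u
  proof (rule carrier_vecI)
    show "dim_vec (?f x u) = r"
      unfolding P_r_def sel_top_def by simp
  qed
  have "(\<exists>xd \<in> carrier_vec r. has_vec_deriv X xd F \<and> 1\<^sub>m r *\<^sub>v xd = ?f x u)
      \<longleftrightarrow> has_vec_deriv X (?f x u) F" for X F x u
  proof -
    have "(\<exists>xd \<in> carrier_vec r. has_vec_deriv X xd F \<and> 1\<^sub>m r *\<^sub>v xd = d)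
        \<longleftrightarrow> has_vec_deriv X d F" if "d \<in> carrier_vec r" for d
      using that by (metis one_mult_mat_vec)
    from this[OF f] show ?thesis .
  qed
  then show ?thesis
    by (simp only: param_system_def ph_system_def)
qed

theorem lemma1:
  fixes r m :: nat and \<theta> :: "real vec" and T :: "real set"
  assumes "0 < r" and "0 < m"
    and "\<theta> \<in> carrier_vec (n_theta r m)"
  shows "pH_DAE T r m (1\<^sub>m r) (J_r r m \<theta>) (R_r r m \<theta>) (Q_r r m \<theta>) (G_r r m \<theta>)
           (P_r r m \<theta>) (S_r r m \<theta>) (N_r r m \<theta>) (param_system T r m \<theta>)"
proof -
  define L where "L = vtu (r + m) (theta_W r m \<theta>)"
  define A where "A = sel_top r m * L"
  define B where "B = sel_bot r m * L"
  have L: "L \<in> carrier_mat (r + m) (r + m)" by (simp add: L_def)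
  have A: "A \<in> carrier_mat r (r + m)" and B: "B \<in> carrier_mat m (r + m)"
    unfolding A_def B_def by (rule mult_carrier_mat[OF _ L], simp)+
  have R: "R_r r m \<theta> = A * transpose_mat A"
    and P: "P_r r m \<theta> = A * transpose_mat B"
    and S: "S_r r m \<theta> = B * transpose_mat B"
    unfolding R_r_def P_r_def S_r_def W_r_def L_def[symmetric] A_def B_def
    by (rule product_of_selected_rows[OF sel_top_carrier[of r m] L sel_top_carrier[of r m]]
        product_of_selected_rows[OF sel_top_carrier[of r m] L sel_bot_carrier[of r m]]
        product_of_selected_rows[OF sel_bot_carrier[of r m] L sel_bot_carrier[of r m]])+
  have Q: "Q_r r m \<theta> \<in> carrier_mat r r"
    unfolding Q_r_def by (rule mult_carrier_mat[OF vtu_carrier]) simp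
  have J: "J_r r m \<theta> \<in> carrier_mat r r"
    unfolding J_r_def by (rule minus_carrier_mat) simp
  have N: "N_r r m \<theta> \<in> carrier_mat m m"
    unfolding N_r_def by (rule minus_carrier_mat) simp
  have "skew_symmetric (transpose_mat (Q_r r m \<theta>) * J_r r m \<theta> * Q_r r m \<theta>)"
    by (rule skew_symmetric_congruence[OF J Q])
      (simp add: J_r_def skew_symmetric_transpose_minus[OF vtsu_carrier])
  moreover have "skew_symmetric (N_r r m \<theta>)"
    by (simp add: N_r_def skew_symmetric_transpose_minus[OF vtsu_carrier])
  moreover have "symmetric_psd (passivity_mat (R_r r m \<theta>) (Q_r r m \<theta>) (P_r r m \<theta>) (S_r r m \<theta>))"
    unfolding R P S by (rule passivity_mat_of_factors_psd[OF A B Q])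
  moreover have "symmetric_psd (transpose_mat (Q_r r m \<theta>) * 1\<^sub>m r)"
  proof -
    have psd: "symmetric_psd (Q_r r m \<theta>)"
      unfolding Q_r_def by (rule symmetric_psd_gram[OF vtu_carrier])
    then have "transpose_mat (Q_r r m \<theta>) = Q_r r m \<theta>"
      by (simp add: symmetric_psd_def)
    then show ?thesis using psd Q by simp
  qed
  moreover have "{1\<^sub>m r, Q_r r m \<theta>, J_r r m \<theta>, R_r r m \<theta>} \<subseteq> carrier_mat r r"
    using J Q mult_carrier_mat[OF A transpose_carrier_mat[THEN iffD2, OF A]] by (simp add: R)
  moreover have "{G_r r m \<theta>, P_r r m \<theta>} \<subseteq> carrier_mat r m"
    using mult_carrier_mat[OF A transpose_carrier_mat[THEN iffD2, OF B]] by (simp add: P G_r_def)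
  moreover have "{S_r r m \<theta>, N_r r m \<theta>} \<subseteq> carrier_mat m m"
    using N mult_carrier_mat[OF B transpose_carrier_mat[THEN iffD2, OF B]] by (simp add: S)
  ultimately show ?thesis
    unfolding pH_DAE_def by (intro conjI param_system_eq_ph_system) assumption+
qed

end
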